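(* Let $G$ be a topological group of Kac-Moody type, with generalised BN-pair $(B,N,S)$, such that $B$ is compact. Then $G$ is unimodular.
   Context: A generalised BN-pair on a group $G$ is a triple $(B,N,S)$ such that: (i) $B,N$ are subgroups of $G$ and $H=B\cap N$ is normal in $N$; (ii) $N/H=\Omega\ltimes W$ with $\Omega$ a subgroup and $W$ a normal subgroup; (iii) $W$ is generated by the set $S$, and (iii.1) for all $\mathbf{t}\in\Omega\ltimes W$ and $\mathbf{s}\in S$, $\dot{\mathbf{t}}B\dot{\mathbf{s}}\subset B\dot{\mathbf{t}}\dot{\mathbf{s}}B\cup B\dot{\mathbf{t}}B$ (dots denote lifts to $G$), (iii.2) $\mathbf{s}^2=1$ and $\dot{\mathbf{s}}B\dot{\mathbf{s}}^{-1}\ne B$ for all $\mathbf{s}\in S$; (iv) $\mathbf{a}S\mathbf{a}^{-1}=S$ for all $\mathbf{a}\in\Omega$; (v) $\dot{\mathbf{a}}B\dot{\mathbf{a}}^{-1}=B$ for all $\mathbf{a}\in\Omega$ and $B\dot{\mathbf{a}}\ne B$ for $\mathbf{a}\in\Omega\setminus\{1\}$; (vi) $G$ is generated by $B$ and $N$. Then $(W,S)$ is a Coxeter system and $G_0:=BWB$ is a normal subgroup of $G$ with BN-pair $(B,N\cap G_0)$. For $J\subseteq S$, $W_J=\langle J\rangle$ and $P_J=BW_JB$; $J$ is spherical if $W_J$ is finite. The Bruhat-Tits building of $G_0$ has as simplices the cosets $\mathbf{g}_0P_J$ ($\mathbf g_0\in G_0$), identified with the parabolic subgroups $\mathbf{g}_0P_J\mathbf{g}_0^{-1}$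 of $G_0$; $G$ acts on it by conjugation, with kernel $K$. $G$ is a topological group of Kac-Moody type if a generalised BN-pair $(B,N,S)$ is selected such that: (1) $G$ is a locally compact totally disconnected topological group; (2) $S$ is finite; (3) $B$ is open in $G$; (4) $B$ contains $K$; (5) if $J\subseteq S$ is spherical, then $P_J/K$ is compact. *)

theory Defs
  imports "HOL-Analysis.Analysis" "HOL-Algebra.Generated_Groups"
begin

section \<open>Topological groups, Haar measures and unimodularity\<close>

locale topological_group = group G for G (structure) +
  fixes T :: "'a topology"
  assumes topspace_eq_carrier: "topspace T = carrier G"
    and continuous_mult: "continuous_map (prod_topology T T) T (\<lambda>(x, y). x \<otimes> y)"
    and continuous_inv: "continuous_map T T (\<lambda>x. inv x)"

definition totally_disconnected_space :: "'a topology \<Rightarrow> bool" where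
  "totally_disconnected_space T \<longleftrightarrow> (\<forall>C. connectedin T C \<longrightarrow> (\<exists>x. C \<subseteq> {x}))"

text \<open>The quotient topology on the set of right cosets of \<open>K\<close>.\<close>

definition coset_topology ::
  "('a, 'b) monoid_scheme \<Rightarrow> 'a topology \<Rightarrow> 'a set \<Rightarrow> 'a set topology" where
  "coset_topology G T K =
     topology (\<lambda>U. U \<subseteq> rcosets\<^bsub>G\<^esub> K \<and> openin T {g \<in> carrier G. K #>\<^bsub>G\<^esub> g \<in> U})"

lemma openin_coset_topology:
  "openin (coset_topology G T K) U \<longleftrightarrow>
     U \<subseteq> rcosets\<^bsub>G\<^esub> K \<and> openin T {g \<in> carrier G. K #>\<^bsub>G\<^esub> g \<in> U}"
proof -
  have "istopology (\<lambda>U. U \<subseteq> rcosets\<^bsub>G\<^esub> K \<and> openin T {g \<in> carrier G. K #>\<^bsub>G\<^esub> g \<in> U})"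
    unfolding istopology_def
  proof (intro conjI allI impI)
    fix U V
    assume U: "U \<subseteq> rcosets\<^bsub>G\<^esub> K \<and> openin T {g \<in> carrier G. K #>\<^bsub>G\<^esub> g \<in> U}"
      and V: "V \<subseteq> rcosets\<^bsub>G\<^esub> K \<and> openin T {g \<in> carrier G. K #>\<^bsub>G\<^esub> g \<in> V}"
    show "U \<inter> V \<subseteq> rcosets\<^bsub>G\<^esub> K" using U by blast
    have "{g \<in> carrier G. K #>\<^bsub>G\<^esub> g \<in> U \<inter> V} =
          {g \<in> carrier G. K #>\<^bsub>G\<^esub> g \<in> U} \<inter> {g \<in> carrier G. K #>\<^bsub>G\<^esub> g \<in> V}" by blast
    then show "openin T {g \<in> carrier G. K #>\<^bsub>G\<^esub> g \<in> U \<inter> V}" using U V by auto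
  next
    fix \<U>
    assume *: "\<forall>U\<in>\<U>. U \<subseteq> rcosets\<^bsub>G\<^esub> K \<and> openin T {g \<in> carrier G. K #>\<^bsub>G\<^esub> g \<in> U}"
    show "\<Union>\<U> \<subseteq> rcosets\<^bsub>G\<^esub> K" using * by blast
    have "{g \<in> carrier G. K #>\<^bsub>G\<^esub> g \<in> \<Union>\<U>} = (\<Union>U\<in>\<U>. {g \<in> carrier G. K #>\<^bsub>G\<^esub> g \<in> U})"
      by blast
    then show "openin T {g \<in> carrier G. K #>\<^bsub>G\<^esub> g \<in> \<Union>\<U>}" using * by auto
  qed
  then show ?thesis by (simp add: coset_topology_def)
qed

lemma (in topological_group) quotient_map_coset_topology:
  assumes "K \<subseteq> carrier G"
  shows "quotient_map T (coset_topology G T K) (\<lambda>g. K #> g)"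
proof -
  have "{g \<in> carrier G. K #> g \<in> rcosets K} = topspace T"
    using assms by (auto simp: topspace_eq_carrier RCOSETS_def)
  then have "openin (coset_topology G T K) (rcosets K)"
    by (simp add: openin_coset_topology)
  then have "topspace (coset_topology G T K) = rcosets K"
    by (metis openin_coset_topology openin_subset openin_topspace subset_antisym)
  then show ?thesis
    unfolding quotient_map_def
    by (auto simp: openin_coset_topology topspace_eq_carrier RCOSETS_def)
qed

text \<open>Haar measures are Radon measures on the Borel sets in the usual convention for locally
  compact groups that need not be \<open>\<sigma>\<close>-compact: outer regular on Borel sets and inner regular
  on open sets.\<close>

definition left_Haar_measure ::
  "('a, 'b) monoid_scheme \<Rightarrow> 'a topology \<Rightarrow> 'a measure \<Rightarrow> bool" where
  "left_Haar_measure G T \<mu> \<longleftrightarrow>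
     sets \<mu> = sets (sigma (topspace T) {U. openin T U}) \<and>
     (\<forall>C. compactin T C \<longrightarrow> emeasure \<mu> C < \<infinity>) \<and>
     (\<forall>A\<in>sets \<mu>. emeasure \<mu> A = (INF U\<in>{U. openin T U \<and> A \<subseteq> U}. emeasure \<mu> U)) \<and>
     (\<forall>U. openin T U \<longrightarrow>
        emeasure \<mu> U = (SUP C\<in>{C. compactin T C \<and> C \<subseteq> U}. emeasure \<mu> C)) \<and>
     emeasure \<mu> (carrier G) \<noteq> 0 \<and>
     (\<forall>g\<in>carrier G. \<forall>A\<in>sets \<mu>. emeasure \<mu> (g <#\<^bsub>G\<^esub> A) = emeasure \<mu> A)"

text \<open>By Haar's theorem a left Haar measure exists on every locally compact group and is unique up
  to a positive factor, so the quantifier over \<open>\<mu>\<close> concerns one measure up to scaling.\<close>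

definition unimodular :: "('a, 'b) monoid_scheme \<Rightarrow> 'a topology \<Rightarrow> bool" where
  "unimodular G T \<longleftrightarrow>
     (\<forall>\<mu>. left_Haar_measure G T \<mu> \<longrightarrow>
        (\<forall>g\<in>carrier G. \<forall>A\<in>sets \<mu>. emeasure \<mu> (A #>\<^bsub>G\<^esub> g) = emeasure \<mu> A))"


section \<open>Generalised BN-pairs\<close>

definition Weyl_quotient ::
  "('a, 'b) monoid_scheme \<Rightarrow> 'a set \<Rightarrow> 'a set \<Rightarrow> 'a set monoid" where
  "Weyl_quotient G B N = (G\<lparr>carrier := N\<rparr>) Mod (B \<inter> N)"

text \<open>Elements of \<open>N/H\<close> are cosets, i.e. subsets of \<open>N\<close>; the lifts to \<open>G\<close> of such an element are
  exactly its members, and the axioms are required for all lifts. The group \<open>W\<close> is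
  determined by \<open>S\<close>; the complement \<open>\<Omega>\<close> is carried along as a parameter.\<close>

locale generalised_BN_pair = group G for G (structure) +
  fixes B N :: "'a set" and S :: "'a set set" and \<Omega> W :: "'a set set"
  assumes subgroup_B: "subgroup B G"
    and subgroup_N: "subgroup N G"
    and normal_H: "(B \<inter> N) \<lhd> G\<lparr>carrier := N\<rparr>"
    and subgroup_\<Omega>: "subgroup \<Omega> (Weyl_quotient G B N)"
    and normal_W: "W \<lhd> Weyl_quotient G B N"
    and \<Omega>_Int_W: "\<Omega> \<inter> W = {\<one>\<^bsub>Weyl_quotient G B N\<^esub>}"
    and \<Omega>_mult_W: "\<Omega> <#>\<^bsub>Weyl_quotient G B N\<^esub> W = carrier (Weyl_quotient G B N)"
    and S_subset: "S \<subseteq> W"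
    and generate_S: "generate (Weyl_quotient G B N) S = W"
    and exchange: "\<lbrakk>t \<in> carrier (Weyl_quotient G B N); s \<in> S; t' \<in> t; s' \<in> s\<rbrakk> \<Longrightarrow>
      (t' <# B) #> s' \<subseteq> ((B #> (t' \<otimes> s')) <#> B) \<union> ((B #> t') <#> B)"
    and S_involution: "s \<in> S \<Longrightarrow> s \<otimes>\<^bsub>Weyl_quotient G B N\<^esub> s = \<one>\<^bsub>Weyl_quotient G B N\<^esub>"
    and S_not_normalising: "\<lbrakk>s \<in> S; s' \<in> s\<rbrakk> \<Longrightarrow> (s' <# B) #> inv s' \<noteq> B"
    and \<Omega>_conj_S: "a \<in> \<Omega> \<Longrightarrow>
      (\<lambda>s. a \<otimes>\<^bsub>Weyl_quotient G B N\<^esub> s \<otimes>\<^bsub>Weyl_quotient G B N\<^esub> inv\<^bsub>Weyl_quotient G B N\<^esub> a) ` S = S"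
    and \<Omega>_normalising: "\<lbrakk>a \<in> \<Omega>; a' \<in> a\<rbrakk> \<Longrightarrow> (a' <# B) #> inv a' = B"
    and \<Omega>_not_in_B: "\<lbrakk>a \<in> \<Omega>; a \<noteq> \<one>\<^bsub>Weyl_quotient G B N\<^esub>; a' \<in> a\<rbrakk> \<Longrightarrow> B #> a' \<noteq> B"
    and generate_B_N: "generate G (B \<union> N) = carrier G"
begin

definition special_subgroup :: "'a set set \<Rightarrow> 'a set set" where
  "special_subgroup J = generate (Weyl_quotient G B N) J"

definition spherical :: "'a set set \<Rightarrow> bool" where
  "spherical J \<longleftrightarrow> finite (special_subgroup J)"

definition standard_parabolic :: "'a set set \<Rightarrow> 'a set" where
  "standard_parabolic J = (B <#> \<Union>(special_subgroup J)) <#> B"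

definition G\<^sub>0 :: "'a set" where
  "G\<^sub>0 = (B <#> \<Union>W) <#> B"

text \<open>Simplices are represented by parabolic subgroups of \<open>G\<^sub>0\<close>, on which \<open>G\<close> acts by conjugation.\<close>

definition building :: "'a set set" where
  "building = {(g <# standard_parabolic J) #> inv g | g J. g \<in> G\<^sub>0 \<and> J \<subseteq> S}"

definition action_kernel :: "'a set" where
  "action_kernel = {g \<in> carrier G. \<forall>P\<in>building. (g <# P) #> inv g = P}"

end


section \<open>Topological groups of Kac-Moody type\<close>

text \<open>Total disconnectedness makes points closed, hence the topology is Hausdorff.\<close>

locale Kac_Moody_topological_group =
  topological_group G T + generalised_BN_pair G B N S \<Omega> W
  for G (structure) and T B N S \<Omega> W +
  assumes locally_compact: "locally_compact_space T"
    and totally_disconnected: "totally_disconnected_space T"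
    and finite_S: "finite S"
    and open_B: "openin T B"
    and kernel_subset_B: "action_kernel \<subseteq> B"
    and compact_parabolics: "\<lbrakk>J \<subseteq> S; spherical J\<rbrakk> \<Longrightarrow>
      compactin (coset_topology G T action_kernel) ((\<lambda>g. action_kernel #> g) ` standard_parabolic J)"

end

theory Submission
  imports Defs
begin

text \<open>A left Haar measure \<open>\<mu>\<close> takes equal values on the left cosets of a compact open subgroup \<open>U\<close>.
  A compact open set \<open>C\<close> with \<open>C U = C\<close> is a finite disjoint union of such cosets, so the ratio
  \<open>\<mu> (C g) / \<mu> C\<close> is the same for all compact open \<open>C\<close>, namely \<open>\<mu> (B g) / \<mu> B\<close>. The elements \<open>g\<close> for
  which this ratio is \<open>1\<close> form a subgroup. It contains \<open>B\<close>, the lifts of \<open>\<Omega>\<close> because they normalise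
  \<open>B\<close>, and the lifts of \<open>S\<close> because their squares lie in \<open>B\<close> and the ratio is a positive real number.
  Hence it is all of \<open>G\<close>. As \<open>G\<close> is totally disconnected, compact open sets determine \<open>\<mu>\<close> on open
  sets, and outer regularity gives the invariance of \<open>\<mu>\<close> on all Borel sets.\<close>

section \<open>Totally disconnected topological groups\<close>

lemma (in group) r_coset_Int:
  assumes "A \<subseteq> carrier G" "C \<subseteq> carrier G" "g \<in> carrier G"
  shows "(A #> g) \<inter> (C #> g) = (A \<inter> C) #> g"
proof -
  have "inj_on (\<lambda>x. x \<otimes> g) (carrier G)"
    using assms(3) by (auto intro!: inj_onI)
  moreover have "X #> g = (\<lambda>x. x \<otimes> g) ` X" for X
    by (auto simp: r_coset_def)
  ultimately show ?thesis
    using assms by (simp add: inj_on_image_Int)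
qed

lemma (in group) r_coset_inv_cancel:
  assumes "A \<subseteq> carrier G" "g \<in> carrier G"
  shows "A #> g #> inv g = A" "A #> inv g #> g = A"
  using assms by (simp_all add: coset_mult_assoc)

context topological_group
begin

section \<open>Translations as homeomorphisms\<close>

lemma openin_subset_carrier: "openin T U \<Longrightarrow> U \<subseteq> carrier G"
  using openin_subset topspace_eq_carrier by blast

lemma compactin_subset_carrier: "compactin T C \<Longrightarrow> C \<subseteq> carrier G"
  using compactin_subset_topspace topspace_eq_carrier by blast

lemma homeomorphic_map_right_mult:
  assumes "g \<in> carrier G"
  shows "homeomorphic_map T T (\<lambda>x. x \<otimes> g)"
proof -
  have "continuous_map T T (\<lambda>x. x \<otimes> h)" if "h \<in> carrier G" for h
  proof -
    have "continuous_map T (prod_topology T T) (\<lambda>x. (x, h))"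
      using that by (simp add: continuous_map_pairwise o_def topspace_eq_carrier)
    from continuous_map_compose[OF this continuous_mult] show ?thesis
      by (simp add: o_def)
  qed
  then have "homeomorphic_maps T T (\<lambda>x. x \<otimes> g) (\<lambda>x. x \<otimes> inv g)"
    using assms by (simp add: homeomorphic_maps_def topspace_eq_carrier m_assoc)
  then show ?thesis
    using homeomorphic_map_maps by blast
qed

lemma homeomorphic_map_left_mult:
  assumes "g \<in> carrier G"
  shows "homeomorphic_map T T (\<lambda>x. g \<otimes> x)"
proof -
  have "continuous_map T T (\<lambda>x. h \<otimes> x)" if "h \<in> carrier G" for h
  proof -
    have "continuous_map T (prod_topology T T) (\<lambda>x. (h, x))"
      using that by (simp add: continuous_map_pairwise o_def topspace_eq_carrier)
    from continuous_map_compose[OF this continuous_mult] show ?thesis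
      by (simp add: o_def)
  qed
  then have "homeomorphic_maps T T (\<lambda>x. g \<otimes> x) (\<lambda>x. inv g \<otimes> x)"
    using assms by (simp add: homeomorphic_maps_def topspace_eq_carrier flip: m_assoc)
  then show ?thesis
    using homeomorphic_map_maps by blast
qed

lemma r_coset_eq_image: "A #> g = (\<lambda>x. x \<otimes> g) ` A"
  by (auto simp: r_coset_def)

lemma l_coset_eq_image: "g <# A = (\<lambda>x. g \<otimes> x) ` A"
  by (auto simp: l_coset_def)

lemma openin_r_coset: "openin T U \<Longrightarrow> g \<in> carrier G \<Longrightarrow> openin T (U #> g)"
  unfolding r_coset_eq_image
  using homeomorphic_map_openness_eq[OF homeomorphic_map_right_mult] by blast

lemma openin_l_coset: "openin T U \<Longrightarrow> g \<in> carrier G \<Longrightarrow> openin T (g <# U)"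
  unfolding l_coset_eq_image
  using homeomorphic_map_openness_eq[OF homeomorphic_map_left_mult] by blast

lemma compactin_r_coset: "compactin T C \<Longrightarrow> g \<in> carrier G \<Longrightarrow> compactin T (C #> g)"
  unfolding r_coset_eq_image
  using homeomorphic_map_compactness_eq[OF homeomorphic_map_right_mult] by blast

lemma compactin_l_coset: "compactin T C \<Longrightarrow> g \<in> carrier G \<Longrightarrow> compactin T (g <# C)"
  unfolding l_coset_eq_image
  using homeomorphic_map_compactness_eq[OF homeomorphic_map_left_mult] by blast

section \<open>Separation and compact open sets\<close>

text \<open>The closure of a point is connected, hence a single point, so the identity is closed.
  The diagonal is its preimage under the continuous map sending \<open>(x, y)\<close> to
  \<open>inv x \<otimes> y\<close>, so the diagonal is closed too.\<close>

lemma Hausdorff_if_totally_disconnected: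
  assumes "totally_disconnected_space T"
  shows "Hausdorff_space T"
proof -
  have "connectedin T (T closure_of {\<one>})"
    by (intro connectedin_closure_of) (simp add: topspace_eq_carrier)
  moreover have "\<one> \<in> T closure_of {\<one>}"
    using closure_of_subset[of "{\<one>}" T] by (simp add: topspace_eq_carrier)
  ultimately have "T closure_of {\<one>} = {\<one>}"
    using assms unfolding totally_disconnected_space_def by blast
  then have closed: "closedin T {\<one>}"
    by (metis closedin_closure_of)
  have "continuous_map (prod_topology T T) T (\<lambda>p. inv (fst p) \<otimes> snd p)"
  proof -
    have "continuous_map (prod_topology T T) (prod_topology T T) (\<lambda>p. (inv (fst p), snd p))"
      using continuous_map_compose[OF continuous_map_fst continuous_inv, of T]
      by (simp add: continuous_map_pairwise o_def continuous_map_snd)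
    from continuous_map_compose[OF this continuous_mult] show ?thesis
      by (simp add: o_def)
  qed
  from closedin_continuous_map_preimage[OF this closed]
  have "closedin (prod_topology T T)
    {p \<in> topspace (prod_topology T T). inv (fst p) \<otimes> snd p \<in> {\<one>}}" .
  moreover have "{p \<in> topspace (prod_topology T T). inv (fst p) \<otimes> snd p \<in> {\<one>}}
      = (\<lambda>x. (x, x)) ` topspace T"
    by (auto simp: topspace_eq_carrier image_iff) (metis inv_equality inv_inv inv_closed)
  ultimately show ?thesis
    by (simp add: Hausdorff_space_closedin_diagonal)
qed

text \<open>In the compact Hausdorff space \<open>V\<close>, a point and a closed set that no
  connected set joins are separated by a clopen set. Such a set is open in \<open>T\<close> because
  \<open>V\<close> is open, and compact because it is closed in \<open>V\<close>.\<close>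

lemma compact_open_neighbourhood:
  assumes td: "totally_disconnected_space T"
    and V: "openin T V" "compactin T V" "x \<in> V" and E: "openin T E" "x \<in> E"
  obtains C where "openin T C" "compactin T C" "x \<in> C" "C \<subseteq> E"
proof -
  let ?X = "subtopology T V"
  have VX: "V \<subseteq> topspace T"
    using V openin_subset by blast
  have haus: "Hausdorff_space ?X"
    using Hausdorff_if_totally_disconnected[OF td] Hausdorff_space_subtopology by blast
  have "separated_between ?X {x} (V - E)"
  \<comment> \<open>The separation condition is cheap here: a connected set has at most one point,
    and \<open>x\<close> lies in \<open>E\<close>, so it cannot meet both \<open>{x}\<close> and
    \<open>V - E\<close>.\<close>
  proof (rule cut_wire_fence_theorem_gen)
    show "compact_space ?X"
      using V compact_space_subtopology by blast
    show "compactin ?X {x}"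
      using V VX by auto
    have "closedin ?X (V \<inter> (topspace T - E))"
      using E by (intro closedin_subtopology_Int_closed) auto
    moreover have "V \<inter> (topspace T - E) = V - E"
      using VX by blast
    ultimately show "closedin ?X (V - E)" by simp
    show "disjnt C {x} \<or> disjnt C (V - E)" if "connectedin ?X C" for C
    proof -
      have "connectedin T C"
        using that connectedin_subtopology by blast
      then obtain y where "C \<subseteq> {y}"
        using td unfolding totally_disconnected_space_def by blast
      then show ?thesis
        using E(2) by (auto simp: disjnt_iff)
    qed
  qed (use haus in auto)
  then obtain C where C: "closedin ?X C" "openin ?X C" "x \<in> C" "V - E \<subseteq> topspace ?X - C"
    unfolding separated_between by auto
  show ?thesis
  proof
    show "openin T C"
      using C V openin_trans_full by blast
    have "compactin ?X C"
      using C V by (intro closedin_compact_space) (auto simp: compact_space_subtopology)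
    then show "compactin T C"
      by (simp add: compactin_subtopology)
    show "C \<subseteq> E"
      using C openin_subset[OF C(2)] by auto
  qed (use C in auto)
qed

text \<open>The translates \<open>x <# B\<close> supply compact open surroundings at every point of
  \<open>K\<close>. Finitely many of the resulting compact open neighbourhoods cover
  \<open>K\<close>, and their union is the required set.\<close>

lemma compact_open_between:
  assumes td: "totally_disconnected_space T"
    and B: "openin T B" "compactin T B" "\<one> \<in> B"
    and K: "compactin T K" and E: "openin T E" "K \<subseteq> E"
  obtains C where "openin T C" "compactin T C" "K \<subseteq> C" "C \<subseteq> E"
proof -
  let ?\<U> = "{C. openin T C \<and> compactin T C \<and> C \<subseteq> E}"
  have "\<exists>C\<in>?\<U>. x \<in> C" if "x \<in> K" for x
  proof -
    have x: "x \<in> carrier G"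
      using K that compactin_subset_carrier by blast
    have "x \<in> x <# B"
      using B x by (force simp: l_coset_def)
    moreover have "x \<in> E"
      using that E(2) by blast
    ultimately obtain C where "openin T C" "compactin T C" "x \<in> C" "C \<subseteq> E"
      using compact_open_neighbourhood[OF td openin_l_coset[OF B(1) x] compactin_l_coset[OF B(2) x] _ E(1)]
      by metis
    then show ?thesis by blast
  qed
  then obtain \<F> where \<F>: "finite \<F>" "\<F> \<subseteq> ?\<U>" "K \<subseteq> \<Union>\<F>"
    using compactinD[OF K, of ?\<U>] by blast
  show ?thesis
  proof
    show "openin T (\<Union>\<F>)" "\<Union>\<F> \<subseteq> E" "K \<subseteq> \<Union>\<F>"
      using \<F> by auto
    show "compactin T (\<Union>\<F>)"
      using \<F> by (intro compactin_Union) auto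
  qed
qed

text \<open>\<open>U\<close> is the stabiliser of \<open>C\<close> in \<open>B\<close> under right
  translation. It makes \<open>C\<close> a union of left cosets of a compact open subgroup, which is
  how \<open>C\<close> is measured later.\<close>

lemma compact_open_right_stabiliser:
  assumes B: "subgroup B G" "openin T B" "compactin T B" and haus: "Hausdorff_space T"
    and C: "openin T C" "compactin T C"
  obtains U where "subgroup U G" "openin T U" "compactin T U" "U \<subseteq> B" "C <#> U \<subseteq> C"
proof -
  interpret B: subgroup B G by (rule B)
  define U where "U = {x \<in> B. C #> x = C}"
  have CG: "C \<subseteq> carrier G"
    using C compactin_subset_carrier by blast
  have U: "subgroup U G"
  proof
    show "U \<subseteq> carrier G" "\<one> \<in> U"
      using CG by (auto simp: U_def)
    show "x \<otimes> y \<in> U" if "x \<in> U" "y \<in> U" for x y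
      using that CG by (auto simp: U_def coset_mult_assoc[symmetric])
    show "inv x \<in> U" if "x \<in> U" for x
      using that r_coset_inv_cancel(1)[OF CG, of x] by (auto simp: U_def)
  qed
  obtain V where V: "openin T V" "\<one> \<in> V" "V \<subseteq> U"
  proof -
    have W: "openin (prod_topology T T)
        {p \<in> topspace (prod_topology T T). (\<lambda>(x, y). x \<otimes> y) p \<in> C}"
      using continuous_mult C(1) by (rule openin_continuous_map_preimage)
    \<comment> \<open>The tube lemma around this slice gives a neighbourhood \<open>Q\<close> of the
      identity with \<open>C <#> Q\<close> inside \<open>C\<close>.\<close>
    have CW: "C \<times> {\<one>} \<subseteq> {p \<in> topspace (prod_topology T T). (\<lambda>(x, y). x \<otimes> y) p \<in> C}"
      using CG by (auto simp: topspace_eq_carrier)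
    have "\<one> \<in> topspace T"
      by (simp add: topspace_eq_carrier)
    then obtain P Q where PQ: "openin T P" "openin T Q" "C \<subseteq> P" "\<one> \<in> Q"
      "P \<times> Q \<subseteq> {p \<in> topspace (prod_topology T T). (\<lambda>(x, y). x \<otimes> y) p \<in> C}"
      using tube_lemma_left[OF W C(2) _ CW] by blast
    have mult: "x \<otimes> y \<in> C" if "x \<in> C" "y \<in> Q" for x y
    proof -
      have "(x, y) \<in> P \<times> Q"
        using that PQ(3) by blast
      from subsetD[OF PQ(5) this] show ?thesis by simp
    qed
    \<comment> \<open>Requiring \<open>inv x\<close> in \<open>Q\<close> as well turns the inclusion
      of \<open>C #> x\<close> in \<open>C\<close> into an equality, so \<open>V\<close> lies in the
      stabiliser.\<close>
    define V where "V = {x \<in> topspace T. inv x \<in> Q} \<inter> (Q \<inter> B)"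
    have "openin T V"
      unfolding V_def using PQ(2) B(2) continuous_inv
      by (intro openin_Int openin_continuous_map_preimage) auto
    moreover have "\<one> \<in> V"
      using PQ by (simp add: V_def topspace_eq_carrier)
    moreover have "C #> x = C" if "x \<in> V" for x
    proof
      have x: "x \<in> carrier G" "x \<in> Q" "inv x \<in> Q"
        using that by (auto simp: V_def)
      show "C #> x \<subseteq> C"
        using mult x by (auto simp: r_coset_def)
      have "C #> inv x \<subseteq> C"
        using mult x by (auto simp: r_coset_def)
      then have "C #> inv x #> x \<subseteq> C #> x"
        by (auto simp: r_coset_def)
      then show "C \<subseteq> C #> x"
        using r_coset_inv_cancel(2)[OF CG x(1)] by simp
    qed
    ultimately show ?thesis
      using that[of V] by (auto simp: U_def V_def)
  qed
  have UG: "U \<subseteq> carrier G"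
    using U subgroup.subset by blast
  have open_U: "openin T U"
  proof (subst openin_subopen, intro ballI exI conjI)
    fix x assume x: "x \<in> U"
    show "openin T (x <# V)"
      using openin_l_coset[OF V(1)] x UG by blast
    show "x \<in> x <# V"
      using V x UG by (force simp: l_coset_def)
    show "x <# V \<subseteq> U"
      using V x subgroup.m_closed[OF U] by (auto simp: l_coset_def)
  qed
  \<comment> \<open>An open subgroup is closed: \<open>U\<close> is what remains of the closed set
    \<open>B\<close> after removing the other left cosets of \<open>U\<close>, which are
    open.\<close>
  have "openin T (\<Union>x\<in>B - U. x <# U)"
    using open_U by (intro openin_Union) (auto intro!: openin_l_coset)
  moreover have "U = B - (\<Union>x\<in>B - U. x <# U)"
  proof -
    have "x \<in> x <# U" if "x \<in> B" for x
      using that U subgroup.one_closed[OF U] by (force simp: l_coset_def)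
    moreover have "x \<in> U" if "y \<in> x <# U" "y \<in> U" "x \<in> B" for x y
      using l_coset_swap[OF that(1) _ U] that subgroup.m_closed[OF U] by (auto simp: l_coset_def)
    moreover have "U \<subseteq> B" by (auto simp: U_def)
    ultimately show ?thesis by blast
  qed
  ultimately have "closedin T U"
    using compactin_imp_closedin[OF haus B(3)] by (metis closedin_diff)
  then have "compactin T U"
    using closed_compactin[OF B(3)] by (auto simp: U_def)
  moreover have "C <#> U \<subseteq> C"
    by (auto simp: U_def set_mult_def r_coset_def)
  ultimately show ?thesis
    using that U open_U by (auto simp: U_def)
qed

end

section \<open>Right translates under a left Haar measure\<close>

locale left_Haar_measured_group = topological_group G T for G (structure) and T +
  fixes \<mu> :: "'a measure"
  assumes left_Haar: "left_Haar_measure G T \<mu>"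
begin

section \<open>Measurability and positivity\<close>

lemma sets_Haar: "sets \<mu> = sigma_sets (carrier G) {U. openin T U}"
  and space_Haar: "space \<mu> = carrier G"
proof -
  have sub: "{U. openin T U} \<subseteq> Pow (topspace T)"
    using openin_subset by auto
  have *: "sets \<mu> = sets (sigma (topspace T) {U. openin T U})"
    using left_Haar by (simp add: left_Haar_measure_def)
  then show "sets \<mu> = sigma_sets (carrier G) {U. openin T U}"
    using sub by (simp add: topspace_eq_carrier)
  show "space \<mu> = carrier G"
    using sets_eq_imp_space_eq[OF *] sub by (simp add: space_measure_of_conv topspace_eq_carrier)
qed

lemma open_in_sets_Haar: "openin T U \<Longrightarrow> U \<in> sets \<mu>"
  unfolding sets_Haar by (simp add: sigma_sets.Basic)

lemma emeasure_compact_finite: "compactin T C \<Longrightarrow> emeasure \<mu> C < \<infinity>"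
  and emeasure_outer_regular:
    "A \<in> sets \<mu> \<Longrightarrow> emeasure \<mu> A = (INF U\<in>{U. openin T U \<and> A \<subseteq> U}. emeasure \<mu> U)"
  and emeasure_inner_regular:
    "openin T U \<Longrightarrow> emeasure \<mu> U = (SUP C\<in>{C. compactin T C \<and> C \<subseteq> U}. emeasure \<mu> C)"
  and emeasure_carrier_neq_0: "emeasure \<mu> (carrier G) \<noteq> 0"
  and emeasure_l_coset: "g \<in> carrier G \<Longrightarrow> A \<in> sets \<mu> \<Longrightarrow> emeasure \<mu> (g <# A) = emeasure \<mu> A"
  using left_Haar by (auto simp: left_Haar_measure_def)

text \<open>\<open>A #> g\<close> is the preimage of \<open>A\<close> under right multiplication by
  \<open>inv g\<close>, which is continuous and hence Borel measurable.\<close>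

lemma r_coset_in_sets_Haar:
  assumes "A \<in> sets \<mu>" "g \<in> carrier G"
  shows "A #> g \<in> sets \<mu>"
proof -
  have "(\<lambda>x. x \<otimes> inv g) \<in> measurable \<mu> \<mu>"
  proof (rule measurable_sigma_sets[OF sets_Haar])
    show "{U. openin T U} \<subseteq> Pow (carrier G)"
      using openin_subset_carrier by auto
    show "(\<lambda>x. x \<otimes> inv g) \<in> space \<mu> \<rightarrow> carrier G"
      using assms by (simp add: space_Haar)
    fix U assume "U \<in> {U. openin T U}"
    moreover have "continuous_map T T (\<lambda>x. x \<otimes> inv g)"
      using assms by (intro homeomorphic_imp_continuous_map homeomorphic_map_right_mult) simp
    ultimately have "openin T {x \<in> topspace T. x \<otimes> inv g \<in> U}"
      by (auto intro: openin_continuous_map_preimage)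
    moreover have "{x \<in> topspace T. x \<otimes> inv g \<in> U} = (\<lambda>x. x \<otimes> inv g) -` U \<inter> space \<mu>"
      by (auto simp: space_Haar topspace_eq_carrier)
    ultimately show "(\<lambda>x. x \<otimes> inv g) -` U \<inter> space \<mu> \<in> sets \<mu>"
      by (simp add: open_in_sets_Haar)
  qed
  from measurable_sets[OF this assms(1)]
  have "(\<lambda>x. x \<otimes> inv g) -` A \<inter> carrier G \<in> sets \<mu>"
    by (simp add: space_Haar)
  moreover have "(\<lambda>x. x \<otimes> inv g) -` A \<inter> carrier G = A #> g"
  proof -
    have "A \<subseteq> carrier G"
      using sets.sets_into_space[OF assms(1)] by (simp add: space_Haar)
    moreover have "x = x \<otimes> inv g \<otimes> g" if "x \<in> carrier G" for x
      using that assms by (simp add: m_assoc)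
    ultimately show ?thesis
      using assms by (auto simp: r_coset_def m_assoc)
  qed
  ultimately show ?thesis by simp
qed

text \<open>If \<open>V\<close> were null, finitely many of its left translates would cover any
  given compact set, so all compact sets would be null. Inner regularity on the open set
  \<open>carrier G\<close> would then make the whole group null.\<close>

lemma emeasure_open_neq_0:
  assumes "openin T V" "\<one> \<in> V"
  shows "emeasure \<mu> V \<noteq> 0"
proof
  assume null: "emeasure \<mu> V = 0"
  have V: "V \<in> sets \<mu>"
    using assms open_in_sets_Haar by blast
  have "emeasure \<mu> K = 0" if "compactin T K" for K
  proof -
    have KG: "K \<subseteq> carrier G"
      using that compactin_subset_carrier by blast
    have "x \<in> x <# V" if "x \<in> K" for x
      using that KG assms by (force simp: l_coset_def)
    then obtain F where F: "finite F" "F \<subseteq> (\<lambda>x. x <# V) ` K" "K \<subseteq> \<Union>F"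
      using compactinD[OF \<open>compactin T K\<close>, of "(\<lambda>x. x <# V) ` K"] openin_l_coset[OF assms(1)] KG
      by blast
    have F_sets: "F \<subseteq> sets \<mu>"
      using F(2) KG openin_l_coset[OF assms(1)] open_in_sets_Haar by blast
    have F_null: "emeasure \<mu> X = 0" if "X \<in> F" for X
      using that F(2) KG emeasure_l_coset[OF _ V] null by auto
    have "emeasure \<mu> K \<le> emeasure \<mu> (\<Union>X\<in>F. X)"
      using F(3) F_sets F(1) by (intro emeasure_mono) auto
    also have "\<dots> \<le> (\<Sum>X\<in>F. emeasure \<mu> X)"
      using F F_sets by (intro emeasure_subadditive_finite) auto
    finally show ?thesis
      using F_null by simp
  qed
  moreover have "openin T (carrier G)"
    by (metis openin_topspace topspace_eq_carrier)
  ultimately have "emeasure \<mu> (carrier G) \<le> 0"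
    by (subst emeasure_inner_regular) (auto simp del: le_zero_eq intro!: SUP_least)
  then show False
    using emeasure_carrier_neq_0 by simp
qed

section \<open>Right translates of compact open sets\<close>

text \<open>\<open>n\<close> counts the left cosets of \<open>U\<close> in \<open>C\<close>. The
  point is that it does not depend on \<open>g\<close>.\<close>

lemma emeasure_r_coset_multiple:
  assumes U: "subgroup U G" "openin T U" and C: "compactin T C" "C <#> U \<subseteq> C"
  obtains n :: nat
    where "\<And>g. g \<in> carrier G \<Longrightarrow> emeasure \<mu> (C #> g) = of_nat n * emeasure \<mu> (U #> g)"
proof -
  interpret U: subgroup U G by (rule U)
  have CG: "C \<subseteq> carrier G"
    using C compactin_subset_carrier by blast
  have "x \<in> x <# U" if "x \<in> C" for x
    using that CG by (force simp: l_coset_def)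
  then obtain F where F: "finite F" "F \<subseteq> (\<lambda>x. x <# U) ` C" "C \<subseteq> \<Union>F"
    using compactinD[OF C(1), of "(\<lambda>x. x <# U) ` C"] openin_l_coset[OF U(2)] CG by blast
  \<comment> \<open>The cover does not overshoot: every \<open>x <# U\<close> with \<open>x\<close>
    in \<open>C\<close> stays in \<open>C\<close> because \<open>C <#> U\<close> does.\<close>
  have FC: "\<Union>F = C"
    using F(2,3) C(2) by (fastforce simp: set_mult_def l_coset_def)
  have FG: "X \<subseteq> carrier G" if "X \<in> F" for X
    using that FC CG by blast
  have disj: "X \<inter> Y = {}" if XY: "X \<in> F" "Y \<in> F" "X \<noteq> Y" for X Y
  proof (rule ccontr)
    assume "X \<inter> Y \<noteq> {}"
    moreover obtain x y where "X = x <# U" "Y = y <# U" "x \<in> carrier G" "y \<in> carrier G"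
      using XY F(2) CG by blast
    ultimately show False
      using XY(3) l_repr_independence[OF _ _ U(1)] by blast
  qed
  show ?thesis
  proof
    fix g assume g: "g \<in> carrier G"
    have X: "X #> g \<in> sets \<mu> \<and> emeasure \<mu> (X #> g) = emeasure \<mu> (U #> g)" if X: "X \<in> F" for X
    proof -
      obtain x where x: "X = x <# U" "x \<in> carrier G"
        using X F(2) CG by blast
      \<comment> \<open>Associativity turns the translated coset into a left translate of
        \<open>U #> g\<close>, where left invariance applies.\<close>
      then have "X #> g = x <# (U #> g)"
        using coset_assoc[OF _ g U.subset] by simp
      moreover have "openin T (U #> g)"
        using U g openin_r_coset by blast
      ultimately show ?thesis
        using x openin_l_coset open_in_sets_Haar emeasure_l_coset by simp
    qed
    have "C #> g = (\<Union>X\<in>F. X #> g)"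
      unfolding FC[symmetric] r_coset_def by blast
    also have "emeasure \<mu> \<dots> = (\<Sum>X\<in>F. emeasure \<mu> (X #> g))"
    proof (rule sum_emeasure[symmetric])
      show "disjoint_family_on (\<lambda>X. X #> g) F"
        unfolding disjoint_family_on_def
        using disj FG g by (simp add: r_coset_Int) (simp add: r_coset_def)
    qed (use X F(1) in auto)
    also have "\<dots> = of_nat (card F) * emeasure \<mu> (U #> g)"
      using X by simp
    finally show "emeasure \<mu> (C #> g) = of_nat (card F) * emeasure \<mu> (U #> g)" .
  qed
qed

text \<open>\<open>B\<close> and \<open>C\<close> are both finite unions of left cosets of one
  subgroup \<open>U\<close>, so both sides are the same multiple of
  \<open>emeasure \<mu> U * emeasure \<mu> (U #> g)\<close>. The cross-multiplied form avoids
  division in \<open>ennreal\<close>.\<close>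

lemma emeasure_r_coset_proportional:
  assumes B: "subgroup B G" "openin T B" "compactin T B" and haus: "Hausdorff_space T"
    and C: "openin T C" "compactin T C" and g: "g \<in> carrier G"
  shows "emeasure \<mu> B * emeasure \<mu> (C #> g) = emeasure \<mu> (B #> g) * emeasure \<mu> C"
proof -
  interpret B: subgroup B G by (rule B)
  obtain U where U: "subgroup U G" "openin T U" "U \<subseteq> B" "C <#> U \<subseteq> C"
    using compact_open_right_stabiliser[OF B haus C] .
  have "B <#> U \<subseteq> B"
    using U(3) by (auto simp: set_mult_def)
  obtain n where n: "\<And>h. h \<in> carrier G \<Longrightarrow> emeasure \<mu> (C #> h) = of_nat n * emeasure \<mu> (U #> h)"
    using emeasure_r_coset_multiple[OF U(1,2) C(2) U(4)] by blast
  obtain m where m: "\<And>h. h \<in> carrier G \<Longrightarrow> emeasure \<mu> (B #> h) = of_nat m * emeasure \<mu> (U #> h)"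
    using emeasure_r_coset_multiple[OF U(1,2) B(3) \<open>B <#> U \<subseteq> B\<close>] by blast
  have "C \<subseteq> carrier G" "U \<subseteq> carrier G"
    using C compactin_subset_carrier subgroup.subset[OF U(1)] by auto
  then show ?thesis
    using n[OF one_closed] m[OF one_closed] n[OF g] m[OF g] by (simp add: B.subset ac_simps)
qed

text \<open>The factor \<open>emeasure \<mu> B\<close> can be cancelled: it is finite since
  \<open>B\<close> is compact, and nonzero since \<open>B\<close> is open and contains the
  identity.\<close>

lemma emeasure_r_coset_eq:
  assumes B: "subgroup B G" "openin T B" "compactin T B" and haus: "Hausdorff_space T"
    and C: "openin T C" "compactin T C" and g: "g \<in> carrier G"
    and eq: "emeasure \<mu> (B #> g) = emeasure \<mu> B"
  shows "emeasure \<mu> (C #> g) = emeasure \<mu> C"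
proof -
  have "emeasure \<mu> B \<noteq> \<infinity>" "emeasure \<mu> B \<noteq> 0"
    using emeasure_compact_finite[OF B(3)]
      emeasure_open_neq_0[OF B(2) subgroup.one_closed[OF B(1)]] by auto
  then show ?thesis
    using emeasure_r_coset_proportional[OF B haus C g] eq by (auto simp: ennreal_mult_cancel_left)
qed

section \<open>From compact open sets to Borel sets\<close>

lemma emeasure_r_coset_invariant:
  assumes td: "totally_disconnected_space T"
    and B: "openin T B" "compactin T B" "\<one> \<in> B"
    and inv: "\<And>C g. openin T C \<Longrightarrow> compactin T C \<Longrightarrow> g \<in> carrier G \<Longrightarrow>
      emeasure \<mu> (C #> g) = emeasure \<mu> C"
    and g: "g \<in> carrier G" and A: "A \<in> sets \<mu>"
  shows "emeasure \<mu> (A #> g) = emeasure \<mu> A"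
proof -
  have open_le: "emeasure \<mu> U \<le> emeasure \<mu> (U #> h)" if U: "openin T U" and h: "h \<in> carrier G" for U h
    unfolding emeasure_inner_regular[OF U]
  proof (rule SUP_least)
    \<comment> \<open>Inner regularity only provides compact sets; enlarging \<open>K\<close> to a
      compact open set inside \<open>U\<close> makes the hypothesis \<open>inv\<close>
      applicable.\<close>
    fix K assume "K \<in> {C. compactin T C \<and> C \<subseteq> U}"
    then obtain C where C: "openin T C" "compactin T C" "K \<subseteq> C" "C \<subseteq> U"
      using compact_open_between[OF td B _ U] by blast
    have "emeasure \<mu> K \<le> emeasure \<mu> C"
      using C by (intro emeasure_mono open_in_sets_Haar)
    also have "\<dots> = emeasure \<mu> (C #> h)"
      using inv[OF C(1,2) h] by simp
    also have "\<dots> \<le> emeasure \<mu> (U #> h)"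
      using C U h by (intro emeasure_mono open_in_sets_Haar openin_r_coset) (auto simp: r_coset_def)
    finally show "emeasure \<mu> K \<le> emeasure \<mu> (U #> h)" .
  qed
  \<comment> \<open>The reverse inequality is \<open>open_le\<close> for the translate
    \<open>U #> h\<close> and the element \<open>inv h\<close>. The same device upgrades
    \<open>le\<close> to an equality at the end.\<close>
  have open_eq: "emeasure \<mu> (U #> h) = emeasure \<mu> U" if U: "openin T U" and h: "h \<in> carrier G" for U h
    using open_le[OF U h] open_le[OF openin_r_coset[OF U h] inv_closed[OF h]]
      r_coset_inv_cancel(1)[OF openin_subset_carrier[OF U] h] by simp
  have le: "emeasure \<mu> (A #> h) \<le> emeasure \<mu> A" if A: "A \<in> sets \<mu>" and h: "h \<in> carrier G" for A h
    unfolding emeasure_outer_regular[OF A]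
  proof (rule INF_greatest)
    fix U assume "U \<in> {U. openin T U \<and> A \<subseteq> U}"
    then have U: "openin T U" "A \<subseteq> U" by auto
    have "emeasure \<mu> (A #> h) \<le> emeasure \<mu> (U #> h)"
      using U h by (intro emeasure_mono open_in_sets_Haar openin_r_coset) (auto simp: r_coset_def)
    then show "emeasure \<mu> (A #> h) \<le> emeasure \<mu> U"
      using open_eq[OF U(1) h] by simp
  qed
  have "A \<subseteq> carrier G"
    using sets.sets_into_space[OF A] by (simp add: space_Haar)
  then show ?thesis
    using le[OF A g] le[OF r_coset_in_sets_Haar[OF A g] inv_closed[OF g]] r_coset_inv_cancel(1)[OF _ g]
    by simp
qed

section \<open>Elements that preserve the measure of \<open>B\<close>\<close>

lemma subgroup_emeasure_r_coset:
  assumes B: "subgroup B G" "openin T B" "compactin T B" and haus: "Hausdorff_space T"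
  shows "subgroup {g \<in> carrier G. emeasure \<mu> (B #> g) = emeasure \<mu> B} G" (is "subgroup ?M G")
proof
  interpret B: subgroup B G by (rule B)
  show "\<one> \<in> ?M" by (simp add: B.subset)
  \<comment> \<open>An element that preserves the measure of \<open>B\<close> preserves that of
    every translate of \<open>B\<close>. Products use the translate \<open>B #> x\<close>, inverses
    the translate \<open>B #> inv x\<close>, which \<open>x\<close> moves back to
    \<open>B\<close>.\<close>
  note eq = emeasure_r_coset_eq[OF B haus openin_r_coset[OF B(2)] compactin_r_coset[OF B(3)]]
  show "x \<otimes> y \<in> ?M" if "x \<in> ?M" "y \<in> ?M" for x y
    using that eq[of x y] by (simp add: coset_mult_assoc B.subset)
  show "inv x \<in> ?M" if "x \<in> ?M" for x
    using that eq[of "inv x" x] by (simp add: r_coset_inv_cancel B.subset)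
qed auto

text \<open>Taking \<open>C\<close> to be \<open>B #> s\<close> in the proportionality, and using
  \<open>B #> s #> s = B\<close>, shows that the measures of \<open>B #> s\<close> and
  \<open>B\<close> have equal squares. Both are finite and nonnegative, so they agree.\<close>

lemma emeasure_r_coset_square:
  assumes B: "subgroup B G" "openin T B" "compactin T B" and haus: "Hausdorff_space T"
    and s: "s \<in> carrier G" "s \<otimes> s \<in> B"
  shows "emeasure \<mu> (B #> s) = emeasure \<mu> B"
proof -
  have BG: "B \<subseteq> carrier G"
    using B subgroup.subset by blast
  have fin: "emeasure \<mu> B \<noteq> \<infinity>" "emeasure \<mu> (B #> s) \<noteq> \<infinity>"
    using emeasure_compact_finite[OF B(3)] emeasure_compact_finite[OF compactin_r_coset[OF B(3) s(1)]]
    by auto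
  have "B #> s #> s = B"
    using s by (simp add: coset_mult_assoc BG coset_join2[OF _ B(1)])
  then have "emeasure \<mu> (B #> s) * emeasure \<mu> (B #> s) = emeasure \<mu> B * emeasure \<mu> B"
    using emeasure_r_coset_proportional[OF B haus openin_r_coset[OF B(2) s(1)] compactin_r_coset[OF B(3) s(1)] s(1)]
    by simp
  then have "measure \<mu> (B #> s) * measure \<mu> (B #> s) = measure \<mu> B * measure \<mu> B"
    by (metis measure_def enn2real_mult)
  then have "measure \<mu> (B #> s) = measure \<mu> B"
    by (metis abs_of_nonneg measure_nonneg real_sqrt_abs2)
  then show ?thesis
    using fin by (simp add: emeasure_eq_ennreal_measure)
qed

end

section \<open>Lifts in a generalised BN-pair\<close>

context generalised_BN_pair
begin

lemma Weyl_quotient_member_subset: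
  assumes "X \<in> carrier (Weyl_quotient G B N)"
  shows "X \<subseteq> N"
proof -
  interpret H: normal "B \<inter> N" "G\<lparr>carrier := N\<rparr>" by (rule normal_H)
  show ?thesis
    using assms H.rcosets_carrier[OF H.is_group]
    by (simp add: Weyl_quotient_def FactGroup_def)
qed

lemma lift_S_square_in_B:
  assumes "s \<in> S" "s' \<in> s"
  shows "s' \<otimes> s' \<in> B"
proof -
  have "s <#> s = B \<inter> N"
    using S_involution[OF assms(1)] by (simp add: Weyl_quotient_def set_mult_def)
  then show ?thesis
    using assms(2) by (auto simp: set_mult_def)
qed

text \<open>Normalisation is put in this form so that a right translate of \<open>B\<close> becomes
  a left translate, to which left invariance applies.\<close>

lemma lift_\<Omega>_commutes_B:
  assumes "a \<in> \<Omega>" "a' \<in> a"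
  shows "a' \<in> carrier G" "B #> a' = a' <# B"
proof -
  have "a \<subseteq> N"
    using assms(1) subgroup.subset[OF subgroup_\<Omega>] Weyl_quotient_member_subset by blast
  then show a': "a' \<in> carrier G"
    using assms(2) subgroup.subset[OF subgroup_N] by blast
  have "a' <# B #> inv a' #> a' = a' <# B"
    using a' subgroup.subset[OF subgroup_B] by (intro r_coset_inv_cancel l_coset_subset_G)
  then show "B #> a' = a' <# B"
    using \<Omega>_normalising[OF assms] by simp
qed

text \<open>As \<open>B\<close> and \<open>N\<close> generate \<open>G\<close>, only
  \<open>N\<close> has to be reached. Each coset in \<open>N/H\<close> is a product of one in
  \<open>\<Omega>\<close> and one in \<open>W\<close>, and members of \<open>W\<close> are handled
  by induction over \<open>generate\<close>.\<close>

lemma subgroup_eq_carrier: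
  assumes M: "subgroup M G" and B: "B \<subseteq> M"
    and \<Omega>: "\<And>a. a \<in> \<Omega> \<Longrightarrow> a \<subseteq> M" and S: "\<And>s. s \<in> S \<Longrightarrow> s \<subseteq> M"
  shows "M = carrier G"
proof -
  interpret M: subgroup M G by (rule M)
  interpret H: normal "B \<inter> N" "G\<lparr>carrier := N\<rparr>" by (rule normal_H)
  interpret Q: group "Weyl_quotient G B N"
    unfolding Weyl_quotient_def by (rule H.factorgroup_is_group)
  have mult: "X \<otimes>\<^bsub>Weyl_quotient G B N\<^esub> Y = X <#> Y" for X Y
    by (simp add: Weyl_quotient_def set_mult_def)
  have "\<one>\<^bsub>Weyl_quotient G B N\<^esub> = B \<inter> N"
    by (simp add: Weyl_quotient_def)
  have SQ: "S \<subseteq> carrier (Weyl_quotient G B N)"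
    using S_subset normal_imp_subgroup[OF normal_W] subgroup.subset by blast
  have W: "X \<subseteq> M" if "X \<in> W" for X
  proof -
    have "X \<in> generate (Weyl_quotient G B N) S"
      using that generate_S by simp
    then show ?thesis
    proof induction
      case one
      then show ?case using B \<open>\<one>\<^bsub>Weyl_quotient G B N\<^esub> = B \<inter> N\<close> by blast
    next
      case (incl s)
      then show ?case using S by blast
    next
      \<comment> \<open>An involution is its own inverse, so this case reduces to the assumption on
        \<open>S\<close>.\<close>
      case (inv s)
      then have "s \<otimes>\<^bsub>Weyl_quotient G B N\<^esub> s = \<one>\<^bsub>Weyl_quotient G B N\<^esub>"
        using S_involution by blast
      then have "inv\<^bsub>Weyl_quotient G B N\<^esub> s = s"
        using inv SQ Q.inv_equality by blast
      then show ?case using S inv by simp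
    next
      case (eng X Y)
      then show ?case by (auto simp: mult set_mult_def)
    qed
  qed
  have "N \<subseteq> M"
  proof
    fix n assume n: "n \<in> N"
    interpret N: subgroup N G by (rule subgroup_N)
    have "(B \<inter> N) #> n \<in> carrier (Weyl_quotient G B N)"
      using n by (auto simp: Weyl_quotient_def carrier_FactGroup)
    then obtain X Y where XY: "X \<in> \<Omega>" "Y \<in> W" "(B \<inter> N) #> n = X <#> Y"
      unfolding \<Omega>_mult_W[symmetric] by (auto simp: set_mult_def[of "Weyl_quotient G B N"] mult)
    have "X <#> Y \<subseteq> M"
      using \<Omega>[OF XY(1)] W[OF XY(2)] by (auto simp: set_mult_def)
    moreover have "n \<in> (B \<inter> N) #> n"
      using n subgroup.one_closed[OF subgroup_B] by (force simp: r_coset_def)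
    ultimately show "n \<in> M"
      using XY(3) by blast
  qed
  then have "generate G (B \<union> N) \<subseteq> M"
    using B M by (intro generate_subgroup_incl) auto
  then show ?thesis
    using generate_B_N M.subset by blast
qed

end

section \<open>Unimodularity from the generators\<close>

theorem theorem6p6:
  fixes G :: "('a, 'b) monoid_scheme" and T :: "'a topology"
    and B N :: "'a set" and S \<Omega> W :: "'a set set"
  assumes "Kac_Moody_topological_group G T B N S \<Omega> W"
    and "compactin T B"
  shows "unimodular G T"
  unfolding unimodular_def
proof (intro allI impI ballI)
  interpret Kac_Moody_topological_group G T B N S \<Omega> W by fact
  fix \<mu> g A
  assume \<mu>: "left_Haar_measure G T \<mu>" and g: "g \<in> carrier G" and A: "A \<in> sets \<mu>"
  interpret left_Haar_measured_group G T \<mu>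
    by unfold_locales (rule \<mu>)
  note B = subgroup_B open_B \<open>compactin T B\<close>
  note haus = Hausdorff_if_totally_disconnected[OF totally_disconnected]
  have BG: "B \<subseteq> carrier G"
    using subgroup.subset[OF subgroup_B] .
  have SQ: "S \<subseteq> carrier (Weyl_quotient G B N)"
    using S_subset normal_imp_subgroup[OF normal_W] subgroup.subset by blast
  \<comment> \<open>\<open>M\<close> consists of the elements of modular ratio 1. Showing that it is
    all of \<open>G\<close> settles invariance for \<open>B\<close>, hence for all compact open
    sets.\<close>
  define M where "M = {g \<in> carrier G. emeasure \<mu> (B #>\<^bsub>G\<^esub> g) = emeasure \<mu> B}"
  have "M = carrier G"
  proof (rule subgroup_eq_carrier)
    show "subgroup M G"
      unfolding M_def by (rule subgroup_emeasure_r_coset[OF B haus])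
    show "B \<subseteq> M"
      using BG coset_join2[OF _ subgroup_B] by (auto simp: M_def)
    show "a \<subseteq> M" if "a \<in> \<Omega>" for a
      using lift_\<Omega>_commutes_B[OF that] emeasure_l_coset open_in_sets_Haar[OF open_B]
      by (auto simp: M_def)
    show "s \<subseteq> M" if "s \<in> S" for s
    proof
      fix s' assume s': "s' \<in> s"
      have "s' \<in> carrier G"
        using s' that SQ Weyl_quotient_member_subset subgroup.subset[OF subgroup_N] by blast
      then show "s' \<in> M"
        using emeasure_r_coset_square[OF B haus] lift_S_square_in_B[OF that s'] by (simp add: M_def)
    qed
  qed
  then have inv_B: "emeasure \<mu> (B #>\<^bsub>G\<^esub> h) = emeasure \<mu> B" if "h \<in> carrier G" for h
    using that by (auto simp: M_def)
  have "emeasure \<mu> (C #>\<^bsub>G\<^esub> h) = emeasure \<mu> C"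
    if "openin T C" "compactin T C" "h \<in> carrier G" for C h
    using emeasure_r_coset_eq[OF B haus that inv_B[OF that(3)]] .
  then show "emeasure \<mu> (A #>\<^bsub>G\<^esub> g) = emeasure \<mu> A"
    using emeasure_r_coset_invariant[OF totally_disconnected B(2,3) subgroup.one_closed[OF subgroup_B] _ g A] by blast
qed

end
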